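(* Let $\mathcal D$ be a weighted oriented forest, i.e. a weighted oriented graph (with arbitrary edge orientations) whose underlying undirected graph is a forest. Then the edge ideal $I(\mathcal D)$ is bridge-friendly and has a Batzies-Welker matching.
   Context: A weighted oriented graph is a triple $\mathcal D=(V,E,\mathbf w)$ with $V$ a finite vertex set, $E$ a set of directed edges whose underlying undirected graph is simple (no loops, no multiple edges), and $\mathbf w:V\to\mathbb N^+$ a weight function. Over a field $\Bbbk$, with $R=\Bbbk[V]$, its edge ideal is $I(\mathcal D)=(xy^{\mathbf w(y)}\mid (x,y)\in E)\subseteq R$, where $(x,y)$ is the edge oriented from $x$ to $y$. Let $I$ be a monomial ideal with minimal monomial generating set $\mathcal G(I)$. Batzies-Welker matching. Let $G=(V,E)$ be the directed graph whose vertices are all subsets of $\mathcal G(I)$ and whose directed edges are the pairs $(\sigma,\sigma')$ with $\sigma'\subseteq\sigma$, $|\sigma'|=|\sigma|-1$. For $A\subseteq E$ let $G^A$ be obtained by reversing the edges in $A$. $A$ is an $\operatorname{lcm}$-homogeneous acyclic matching if every subset of $\mathcal G(I)$ appears in at most one edge of $A$, $G^A$ has no directed cycle, and $\operatorname{lcm}(\sigma)=\operatorname{lcm}(\sigma')$ for all $(\sigma,\sigma')\in A$. Subsets not appearing in any edge of $A$ are called critical. An $\operatorname{lcm}$-homogeneous acyclic matching is a Batzies-Welker matching if $\operatorname{lcm}(\sigma)\ne\operatorname{lcm}(\sigma')$ for any two distinct critical subsets $\sigma,\sigma'$ of $\mathcal G(I)$. Bridge-friendliness. Given a total ordering $>_I$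 on $\mathcal G(I)$: $m\in\mathcal G(I)$ is a bridge of $\sigma\subseteq\mathcal G(I)$ if $m\in\sigma$ and $\operatorname{lcm}(\sigma\setminus m)=\operatorname{lcm}(\sigma)$; $\operatorname{sb}(\sigma)$ is the $>_I$-smallest bridge of $\sigma$ if one exists, and $\emptyset$ otherwise ($\sigma\setminus\emptyset=\sigma$). Barile-Macchia algorithm: start with $A=\emptyset$, $\Omega=\{\sigma\subseteq\mathcal G(I):|\sigma|\ge3\}$. (1) Pick $\sigma\in\Omega$ of maximal cardinality. (2) Replace $\Omega$ by $\Omega\setminus\{\sigma,\sigma\setminus\operatorname{sb}(\sigma)\}$; if $\operatorname{sb}(\sigma)\neq\emptyset$ add the directed edge $(\sigma,\sigma\setminus\operatorname{sb}(\sigma))$ to $A$; if $\Omega\ne\emptyset$ return to (1). (3) Whenever two distinct edges $(\sigma,\sigma\setminus\operatorname{sb}(\sigma))$, $(\sigma',\sigma'\setminus\operatorname{sb}(\sigma'))$ of $A$ have the same target, remove the one whose smallest bridge is larger with respect to $>_I$. A subset $\sigma$ is potentially-type-2 if the edge $(\sigma,\sigma\setminus\operatorname{sb}(\sigma))$ is added to $A$ in step (2); it is type-2 if this edge remains in the final $A$. $I$ is bridge-friendly if there exists a total ordering $>_I$ on $\mathcal G(I)$ such that all potentially-type-2 subsets of $\mathcal G(I)$ are type-2. *)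

theory Defs
  imports "HOL-Algebra.Ideal" "HOL-Library.Poly_Mapping" "HOL-Library.Confluence"
begin

section \<open>Polynomial rings and monomials\<close>

text \<open>
  A monomial is identified with its exponent vector, of type \<^typ>\<open>'v \<Rightarrow>\<^sub>0 nat\<close>; the product of
  monomials is the sum of exponent vectors.  A polynomial is a finitely supported map from monomials
  to coefficients, with the (convolution) ring structure of \<^typ>\<open>('v \<Rightarrow>\<^sub>0 nat) \<Rightarrow>\<^sub>0 'k\<close>.
\<close>

type_synonym 'v monomial = "'v \<Rightarrow>\<^sub>0 nat"
type_synonym ('v, 'k) mpoly = "'v monomial \<Rightarrow>\<^sub>0 'k"

definition monomials :: "'v set \<Rightarrow> 'v monomial set" where
  "monomials V = {t. Poly_Mapping.keys t \<subseteq> V}"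

definition mon :: "'v monomial \<Rightarrow> ('v, 'k::field) mpoly" where
  "mon t = Poly_Mapping.single t 1"

definition var :: "'v \<Rightarrow> ('v, 'k::field) mpoly" where
  "var x = mon (Poly_Mapping.single x 1)"

definition poly_ring :: "'v set \<Rightarrow> ('v, 'k::field) mpoly ring" where
  "poly_ring V =
     \<lparr>carrier = {p. Poly_Mapping.keys p \<subseteq> monomials V},
      mult = (*), one = 1, zero = 0, add = (+)\<rparr>"

definition mon_lcm :: "'v monomial set \<Rightarrow> 'v monomial" where
  "mon_lcm \<sigma> = Abs_poly_mapping (\<lambda>x. Max (insert 0 ((\<lambda>m. Poly_Mapping.lookup m x) ` \<sigma>)))"

definition is_min_gens :: "'v set \<Rightarrow> ('v, 'k::field) mpoly set \<Rightarrow> 'v monomial set \<Rightarrow> bool" where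
  "is_min_gens V I G \<longleftrightarrow>
     G \<subseteq> monomials V \<and> Idl\<^bsub>poly_ring V\<^esub> (mon ` G) = I \<and>
     (\<forall>G'. G' \<subset> G \<longrightarrow> Idl\<^bsub>poly_ring V\<^esub> (mon ` G') \<noteq> I)"

text \<open>Well-defined by \<open>is_min_gens_unique\<close> below, for ideals having such a generating set.\<close>

definition min_gens :: "'v set \<Rightarrow> ('v, 'k::field) mpoly set \<Rightarrow> 'v monomial set" where
  "min_gens V I = (THE G. is_min_gens V I G)"


section \<open>Weighted oriented forests and their edge ideals\<close>

text \<open>
  The pair \<open>(x, y) \<in> E\<close> is the edge oriented from \<open>x\<close> to \<open>y\<close>.  Only the values of \<open>w\<close> on \<open>V\<close> matter.
\<close>

locale weighted_oriented_graph =
  fixes V :: "'v set" and E :: "('v \<times> 'v) set" and w :: "'v \<Rightarrow> nat"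
  assumes finite_verts: "finite V"
    and edges_in_verts: "E \<subseteq> V \<times> V"
    and no_loops: "(x, y) \<in> E \<Longrightarrow> x \<noteq> y"
    and no_multi_edges: "(x, y) \<in> E \<Longrightarrow> (y, x) \<notin> E"
    and weight_pos: "x \<in> V \<Longrightarrow> w x \<ge> 1"

definition undirected_cycle :: "('v \<times> 'v) set \<Rightarrow> 'v list \<Rightarrow> bool" where
  "undirected_cycle E c \<longleftrightarrow>
     length c \<ge> 3 \<and> distinct c \<and>
     successively (\<lambda>x y. (x, y) \<in> E \<union> E\<inverse>) c \<and> (last c, hd c) \<in> E \<union> E\<inverse>"

locale weighted_oriented_forest = weighted_oriented_graph +
  assumes no_cycles: "\<not> undirected_cycle E c"

definition edge_ideal ::
    "'v set \<Rightarrow> ('v \<times> 'v) set \<Rightarrow> ('v \<Rightarrow> nat) \<Rightarrow> ('v, 'k::field) mpoly set" where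
  "edge_ideal V E w = Idl\<^bsub>poly_ring V\<^esub> {var x * var y ^ w y | x y. (x, y) \<in> E}"


section \<open>Batzies-Welker matchings\<close>

definition subset_graph :: "'m set \<Rightarrow> ('m set \<times> 'm set) set" where
  "subset_graph G = {(\<sigma>, \<sigma>'). \<sigma> \<subseteq> G \<and> \<sigma>' \<subseteq> \<sigma> \<and> card \<sigma> = card \<sigma>' + 1}"

definition reverse_edges :: "('a \<times> 'a) set \<Rightarrow> ('a \<times> 'a) set \<Rightarrow> ('a \<times> 'a) set" where
  "reverse_edges D A = (D - A) \<union> A\<inverse>"

definition lcm_homogeneous_acyclic_matching ::
    "'v monomial set \<Rightarrow> ('v monomial set \<times> 'v monomial set) set \<Rightarrow> bool" where
  "lcm_homogeneous_acyclic_matching G A \<longleftrightarrow>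
     A \<subseteq> subset_graph G \<and>
     (\<forall>\<sigma>. \<sigma> \<subseteq> G \<longrightarrow> (\<forall>e\<in>A. \<forall>e'\<in>A. \<sigma> \<in> {fst e, snd e} \<longrightarrow> \<sigma> \<in> {fst e', snd e'} \<longrightarrow> e = e')) \<and>
     acyclic (reverse_edges (subset_graph G) A) \<and>
     (\<forall>(\<sigma>, \<sigma>')\<in>A. mon_lcm \<sigma> = mon_lcm \<sigma>')"

definition critical :: "'m set \<Rightarrow> ('m set \<times> 'm set) set \<Rightarrow> 'm set \<Rightarrow> bool" where
  "critical G A \<sigma> \<longleftrightarrow> \<sigma> \<subseteq> G \<and> (\<forall>e\<in>A. \<sigma> \<notin> {fst e, snd e})"

definition batzies_welker_matching ::
    "'v monomial set \<Rightarrow> ('v monomial set \<times> 'v monomial set) set \<Rightarrow> bool" where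
  "batzies_welker_matching G A \<longleftrightarrow>
     lcm_homogeneous_acyclic_matching G A \<and>
     (\<forall>\<sigma> \<sigma>'. critical G A \<sigma> \<and> critical G A \<sigma>' \<and> \<sigma> \<noteq> \<sigma>' \<longrightarrow> mon_lcm \<sigma> \<noteq> mon_lcm \<sigma>')"

definition has_batzies_welker_matching :: "'v set \<Rightarrow> ('v, 'k::field) mpoly set \<Rightarrow> bool" where
  "has_batzies_welker_matching V I \<longleftrightarrow> (\<exists>A. batzies_welker_matching (min_gens V I) A)"


section \<open>The Barile-Macchia algorithm and bridge-friendliness\<close>

text \<open>
  A total ordering of the generators is a reflexive linear order \<open>r\<close> on the set of generators, in
  the sense of \<^const>\<open>linear_order_on\<close>; \<open>(m, m') \<in> r\<close> means that \<open>m\<close> is smaller than or equal to \<open>m'\<close>.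
\<close>

definition bridge :: "'v monomial set \<Rightarrow> 'v monomial \<Rightarrow> bool" where
  "bridge \<sigma> m \<longleftrightarrow> m \<in> \<sigma> \<and> mon_lcm (\<sigma> - {m}) = mon_lcm \<sigma>"

text \<open>
  The smallest bridge, as a set: the singleton of the smallest bridge if there is a bridge, and
  \<open>{}\<close> otherwise.  Thus \<open>\<sigma> - sb r \<sigma>\<close> is \<open>\<sigma>\<close> without its smallest bridge (or \<open>\<sigma>\<close> itself).
\<close>

definition sb :: "'v monomial rel \<Rightarrow> 'v monomial set \<Rightarrow> 'v monomial set" where
  "sb r \<sigma> = {m. bridge \<sigma> m \<and> (\<forall>m'. bridge \<sigma> m' \<longrightarrow> (m, m') \<in> r)}"

type_synonym 'v bm_state =
  "'v monomial set set \<times> ('v monomial set \<times> 'v monomial set) set"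

text \<open>One pass through steps (1) and (2), on states \<open>(\<Omega>, A)\<close>.\<close>

inductive bm_step :: "'v monomial rel \<Rightarrow> 'v bm_state \<Rightarrow> 'v bm_state \<Rightarrow> bool" for r where
  "\<lbrakk>\<sigma> \<in> \<Omega>; \<And>\<tau>. \<tau> \<in> \<Omega> \<Longrightarrow> card \<tau> \<le> card \<sigma>\<rbrakk> \<Longrightarrow>
   bm_step r (\<Omega>, A)
     (\<Omega> - {\<sigma>, \<sigma> - sb r \<sigma>}, if sb r \<sigma> = {} then A else insert (\<sigma>, \<sigma> - sb r \<sigma>) A)"

text \<open>
  \<open>A\<close> is the edge set on reaching step (3).  It exists and does not depend on the choices
  made in step (1), see \<open>bm_matched_ex1\<close> below.
\<close>

definition bm_matched ::
    "'v monomial set \<Rightarrow> 'v monomial rel \<Rightarrow> ('v monomial set \<times> 'v monomial set) set \<Rightarrow> bool" where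
  "bm_matched G r A \<longleftrightarrow> (bm_step r)\<^sup>*\<^sup>* ({\<sigma>. \<sigma> \<subseteq> G \<and> card \<sigma> \<ge> 3}, {}) ({}, A)"

text \<open>
  Step (3): among the edges with a common target, only the one whose source has the smallest \<open>sb\<close>
  survives.  Edges with distinct sources and the same target have distinct smallest bridges.
\<close>

definition bm_prune ::
    "'v monomial rel \<Rightarrow> ('v monomial set \<times> 'v monomial set) set
      \<Rightarrow> ('v monomial set \<times> 'v monomial set) set" where
  "bm_prune r A = {(\<sigma>, \<tau>) \<in> A. \<not> (\<exists>\<sigma>'. (\<sigma>', \<tau>) \<in> A \<and> \<sigma>' \<noteq> \<sigma> \<and>
     (\<exists>m\<in>sb r \<sigma>. \<exists>m'\<in>sb r \<sigma>'. (m', m) \<in> r \<and> m' \<noteq> m))}"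

definition potentially_type2 :: "'v monomial set \<Rightarrow> 'v monomial rel \<Rightarrow> 'v monomial set \<Rightarrow> bool" where
  "potentially_type2 G r \<sigma> \<longleftrightarrow> (\<exists>A. bm_matched G r A \<and> (\<sigma>, \<sigma> - sb r \<sigma>) \<in> A)"

definition type2 :: "'v monomial set \<Rightarrow> 'v monomial rel \<Rightarrow> 'v monomial set \<Rightarrow> bool" where
  "type2 G r \<sigma> \<longleftrightarrow> (\<exists>A. bm_matched G r A \<and> (\<sigma>, \<sigma> - sb r \<sigma>) \<in> bm_prune r A)"

definition bridge_friendly :: "'v set \<Rightarrow> ('v, 'k::field) mpoly set \<Rightarrow> bool" where
  "bridge_friendly V I \<longleftrightarrow>
     (\<exists>r. linear_order_on (min_gens V I) r \<and>
       (\<forall>\<sigma>. \<sigma> \<subseteq> min_gens V I \<longrightarrow>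
         potentially_type2 (min_gens V I) r \<sigma> \<longrightarrow> type2 (min_gens V I) r \<sigma>))"


section \<open>Well-definedness\<close>

lemma lookup_mon_lcm:
  assumes "finite \<sigma>"
  shows "Poly_Mapping.lookup (mon_lcm \<sigma>) x = Max (insert 0 ((\<lambda>m. Poly_Mapping.lookup m x) ` \<sigma>))"
proof -
  have "{x. Max (insert 0 ((\<lambda>m. Poly_Mapping.lookup m x) ` \<sigma>)) \<noteq> 0} \<subseteq> (\<Union>m\<in>\<sigma>. Poly_Mapping.keys m)"
  proof
    fix x assume "x \<in> {x. Max (insert 0 ((\<lambda>m. Poly_Mapping.lookup m x) ` \<sigma>)) \<noteq> 0}"
    moreover have "Max (insert 0 ((\<lambda>m. Poly_Mapping.lookup m x) ` \<sigma>)) \<in> insert 0 ((\<lambda>m. Poly_Mapping.lookup m x) ` \<sigma>)"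
      using assms by (intro Max_in) auto
    ultimately show "x \<in> (\<Union>m\<in>\<sigma>. Poly_Mapping.keys m)"
      by (auto simp: in_keys_iff)
  qed
  then have "finite {x. Max (insert 0 ((\<lambda>m. Poly_Mapping.lookup m x) ` \<sigma>)) \<noteq> 0}"
    using assms finite_subset by fastforce
  then show ?thesis
    by (simp add: mon_lcm_def Abs_poly_mapping_inverse)
qed

lemma monomials_add: "s \<in> monomials V \<Longrightarrow> t \<in> monomials V \<Longrightarrow> s + t \<in> monomials V"
  using keys_add[of s t] by (auto simp: monomials_def)

lemma monomials_addD:
  assumes "s + t \<in> monomials V"
  shows "s \<in> monomials V" "t \<in> monomials V"
  using assms by (auto simp: monomials_def in_keys_iff lookup_add subset_iff)

lemma cring_poly_ring: "cring (poly_ring V :: ('v, 'k::field) mpoly ring)"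
proof (rule cringI)
  show "abelian_group (poly_ring V :: ('v, 'k) mpoly ring)"
  proof (rule abelian_groupI)
    fix p :: "('v, 'k) mpoly" assume p: "p \<in> carrier (poly_ring V)"
    then show "\<exists>q\<in>carrier (poly_ring V). q \<oplus>\<^bsub>poly_ring V\<^esub> p = \<zero>\<^bsub>poly_ring V\<^esub>"
      by (intro bexI[of _ "- p"]) (auto simp: poly_ring_def in_keys_iff)
  next
    fix p q :: "('v, 'k) mpoly" 
    assume "p \<in> carrier (poly_ring V)" "q \<in> carrier (poly_ring V)"
    then show "p \<oplus>\<^bsub>poly_ring V\<^esub> q \<in> carrier (poly_ring V)"
      using keys_add[of p q] by (auto simp: poly_ring_def)
  qed (auto simp: poly_ring_def algebra_simps)
  show "comm_monoid (poly_ring V :: ('v, 'k) mpoly ring)"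
  proof (rule comm_monoidI)
    fix p q :: "('v, 'k) mpoly" 
    assume "p \<in> carrier (poly_ring V)" "q \<in> carrier (poly_ring V)"
    then show "p \<otimes>\<^bsub>poly_ring V\<^esub> q \<in> carrier (poly_ring V)"
      using keys_mult[of p q] by (fastforce simp: poly_ring_def intro: monomials_add)
  qed (auto simp: poly_ring_def algebra_simps monomials_def)
qed (auto simp: poly_ring_def algebra_simps)

lemma mon_mult: "mon s * mon t = mon (s + t)"
  by (simp add: mon_def mult_single)

lemma mon_in_carrier: "mon t \<in> carrier (poly_ring V) \<longleftrightarrow> t \<in> monomials V"
  by (simp add: mon_def poly_ring_def)

lemma Idl_mon_divides:
  fixes p :: "('v, 'k::field) mpoly"
  assumes "M \<subseteq> monomials V" "p \<in> Idl\<^bsub>poly_ring V\<^esub> (mon ` M)" "t \<in> Poly_Mapping.keys p"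
  shows "\<exists>m\<in>M. \<exists>s. t = m + s"
proof -
  interpret R: cring "poly_ring V :: ('v, 'k) mpoly ring" by (rule cring_poly_ring)
  let ?R = "poly_ring V :: ('v, 'k) mpoly ring"
  let ?J = "{p \<in> carrier ?R. \<forall>t\<in>Poly_Mapping.keys p. \<exists>m\<in>M. \<exists>s. t = m + s}"
  have mult: "a \<otimes>\<^bsub>?R\<^esub> x \<in> ?J" if "a \<in> ?J" "x \<in> carrier ?R" for a x
  proof -
    have "\<exists>m\<in>M. \<exists>s. t = m + s" if "t \<in> Poly_Mapping.keys (a * x)" for t
    proof -
      from that keys_mult[of a x] obtain u v where "t = u + v" "u \<in> Poly_Mapping.keys a" by auto
      with \<open>a \<in> ?J\<close> obtain m s where "m \<in> M" "t = m + (s + v)" by (auto simp: add.assoc)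
      then show ?thesis by blast
    qed
    moreover have "a \<otimes>\<^bsub>?R\<^esub> x \<in> carrier ?R" using that by auto
    ultimately show ?thesis by (auto simp: poly_ring_def)
  qed
  have "ideal ?J ?R"
  proof (rule idealI)
    show "ring ?R" by (rule R.ring_axioms)
    show "subgroup ?J (add_monoid ?R)"
    proof (rule R.add.subgroupI)
      show "?J \<noteq> {}" by (auto simp: poly_ring_def intro!: exI[of _ 0])
    next
      fix a assume a: "a \<in> ?J"
      then have c: "- a \<in> carrier ?R" by (auto simp: poly_ring_def)
      have "\<ominus>\<^bsub>?R\<^esub> a = - a"
        using a c by (intro R.minus_equality) (auto simp: poly_ring_def)
      with a c show "\<ominus>\<^bsub>?R\<^esub> a \<in> ?J" by auto
    next
      fix a b assume "a \<in> ?J" "b \<in> ?J"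
      moreover from this have "a \<oplus>\<^bsub>?R\<^esub> b \<in> carrier ?R" by auto
      ultimately show "a \<oplus>\<^bsub>?R\<^esub> b \<in> ?J"
        using keys_add[of a b] by (auto simp: poly_ring_def dest!: subsetD)
    qed auto
    fix a x assume ax: "a \<in> ?J" "x \<in> carrier ?R"
    then show "a \<otimes>\<^bsub>?R\<^esub> x \<in> ?J" by (rule mult)
    with ax show "x \<otimes>\<^bsub>?R\<^esub> a \<in> ?J" using R.m_comm by auto
  qed
  moreover have "mon ` M \<subseteq> ?J"
  proof
    fix q :: "('v, 'k) mpoly" assume "q \<in> mon ` M"
    then obtain m where m: "m \<in> M" "q = mon m" by auto
    then have "q \<in> carrier ?R" using assms(1) by (auto simp: mon_in_carrier)
    moreover have "\<exists>m'\<in>M. \<exists>s. m = m' + s" using m by (intro bexI[of _ m] exI[of _ 0]) auto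
    ultimately show "q \<in> ?J" using m by (auto simp: mon_def)
  qed
  ultimately have "Idl\<^bsub>?R\<^esub> (mon ` M) \<subseteq> ?J" by (rule R.genideal_minimal)
  with assms show ?thesis by blast
qed

lemma is_min_gens_subset:
  fixes I :: "('v, 'k::field) mpoly set"
  assumes G: "is_min_gens V I G" and H: "is_min_gens V I H"
  shows "G \<subseteq> H"
proof
  interpret R: cring "poly_ring V :: ('v, 'k) mpoly ring" by (rule cring_poly_ring)
  let ?R = "poly_ring V :: ('v, 'k) mpoly ring"
  have sub: "mon ` X \<subseteq> carrier ?R" if "X \<subseteq> monomials V" for X
    using that by (auto simp: mon_in_carrier)
  have GV: "G \<subseteq> monomials V" and HV: "H \<subseteq> monomials V"
    and GI: "Idl\<^bsub>?R\<^esub> (mon ` G) = I" and HI: "Idl\<^bsub>?R\<^esub> (mon ` H) = I"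
    using G H by (auto simp: is_min_gens_def)
  fix m assume m: "m \<in> G"
  have "mon m \<in> Idl\<^bsub>?R\<^esub> (mon ` H)" using R.genideal_self[OF sub[OF GV]] m GI HI by auto
  then obtain h s where h: "h \<in> H" "m = h + s"
    using Idl_mon_divides[OF HV, of "mon m :: ('v, 'k) mpoly" m] by (auto simp: mon_def)
  have "mon h \<in> Idl\<^bsub>?R\<^esub> (mon ` G)" using R.genideal_self[OF sub[OF HV]] h GI HI by auto
  then obtain g u where g: "g \<in> G" "h = g + u"
    using Idl_mon_divides[OF GV, of "mon h :: ('v, 'k) mpoly" h] by (auto simp: mon_def)
  have m_eq: "m = g + (u + s)" using h g by (simp add: add.assoc)
  show "m \<in> H"
  proof (cases "g = m")
    case True
    with m_eq have "u + s = 0" by simp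
    then have "s = 0"
      by (intro poly_mapping_eqI) (metis add_is_0 lookup_add lookup_zero)
    with h show ?thesis by simp
  next
    case False
    let ?G' = "G - {m}"
    have G'V: "?G' \<subseteq> monomials V" using GV by auto
    have id': "ideal (Idl\<^bsub>?R\<^esub> (mon ` ?G')) ?R" by (rule R.genideal_ideal[OF sub[OF G'V]])
    have "u + s \<in> monomials V" using m_eq m GV monomials_addD(2) by blast
    then have "mon g \<otimes>\<^bsub>?R\<^esub> mon (u + s) \<in> Idl\<^bsub>?R\<^esub> (mon ` ?G')"
      using False g R.genideal_self[OF sub[OF G'V]]
      by (intro ideal.I_r_closed[OF id']) (auto simp: mon_in_carrier)
    moreover have "mon g \<otimes>\<^bsub>?R\<^esub> mon (u + s) = (mon m :: ('v, 'k) mpoly)"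
      using m_eq mon_mult[of g "u + s"] by (simp add: poly_ring_def)
    ultimately have "mon ` G \<subseteq> Idl\<^bsub>?R\<^esub> (mon ` ?G')"
      using R.genideal_self[OF sub[OF G'V]] by auto
    then have "Idl\<^bsub>?R\<^esub> (mon ` G) \<subseteq> Idl\<^bsub>?R\<^esub> (mon ` ?G')"
      by (rule R.genideal_minimal[OF id'])
    moreover have "Idl\<^bsub>?R\<^esub> (mon ` ?G') \<subseteq> Idl\<^bsub>?R\<^esub> (mon ` G)"
      using R.genideal_self[OF sub[OF GV]]
      by (intro R.genideal_minimal R.genideal_ideal sub GV) auto
    ultimately have "Idl\<^bsub>?R\<^esub> (mon ` ?G') = I" using GI by auto
    moreover have "?G' \<subset> G" using m by auto
    ultimately show ?thesis using G by (auto simp: is_min_gens_def)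
  qed
qed

lemma is_min_gens_unique: "is_min_gens V I G \<Longrightarrow> is_min_gens V I H \<Longrightarrow> G = H"
  by (simp add: is_min_gens_subset subset_antisym)

lemma min_gens_eq: "is_min_gens V I G \<Longrightarrow> min_gens V I = G"
  unfolding min_gens_def by (rule the_equality) (simp_all add: is_min_gens_unique[of V I _ G])

definition edge_mon :: "('v \<Rightarrow> nat) \<Rightarrow> 'v \<times> 'v \<Rightarrow> 'v monomial" where
  "edge_mon w e = Poly_Mapping.single (fst e) 1 + Poly_Mapping.single (snd e) (w (snd e))"

lemma mon_edge_mon: "mon (edge_mon w (x, y)) = var x * var y ^ w y"
proof -
  have pow: "var y ^ n = mon (Poly_Mapping.single y n)" for n
    by (induction n) (simp_all add: var_def mon_mult flip: single_add, simp add: mon_def)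
  show ?thesis by (simp add: edge_mon_def pow, simp add: var_def mon_mult)
qed

context weighted_oriented_graph
begin

lemma keys_edge_mon:
  assumes "(x, y) \<in> E"
  shows "Poly_Mapping.keys (edge_mon w (x, y)) = {x, y}"
proof -
  have "w y \<ge> 1" using assms edges_in_verts weight_pos by auto
  then show ?thesis
    using no_loops[OF assms]
    by (auto simp: edge_mon_def in_keys_iff lookup_add lookup_single when_def split: if_splits)
qed

lemma is_min_gens_edge_ideal:
  "is_min_gens V (edge_ideal V E w :: ('v, 'k::field) mpoly set) (edge_mon w ` E)"
  unfolding is_min_gens_def
proof (intro conjI allI impI)
  let ?R = "poly_ring V :: ('v, 'k) mpoly ring"
  interpret R: cring ?R by (rule cring_poly_ring)
  show sub: "edge_mon w ` E \<subseteq> monomials V"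
    using edges_in_verts by (auto simp: monomials_def keys_edge_mon)
  have "mon ` edge_mon w ` E = ({var x * var y ^ w y | x y. (x, y) \<in> E} :: ('v, 'k) mpoly set)"
    by (force simp: mon_edge_mon[symmetric])
  then show gen: "Idl\<^bsub>?R\<^esub> (mon ` edge_mon w ` E) = edge_ideal V E w"
    by (simp add: edge_ideal_def)
  fix G' assume G': "G' \<subset> edge_mon w ` E"
  then obtain x y where e: "(x, y) \<in> E" "edge_mon w (x, y) \<notin> G'" by auto
  show "Idl\<^bsub>?R\<^esub> (mon ` G') \<noteq> edge_ideal V E w"
  proof
    assume "Idl\<^bsub>?R\<^esub> (mon ` G') = edge_ideal V E w"
    moreover have "mon ` edge_mon w ` E \<subseteq> carrier ?R" using sub by (auto simp: mon_in_carrier)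
    ultimately have "mon (edge_mon w (x, y)) \<in> Idl\<^bsub>?R\<^esub> (mon ` G')"
      using R.genideal_self[of "mon ` edge_mon w ` E"] gen e by auto
    then obtain m s where m: "m \<in> G'" "edge_mon w (x, y) = m + s"
      using Idl_mon_divides[of G' V "mon (edge_mon w (x, y)) :: ('v, 'k) mpoly" "edge_mon w (x, y)"]
        psubset_imp_subset[OF G'] sub
      by (simp add: mon_def) (meson order_trans)
    obtain a b where ab: "(a, b) \<in> E" "m = edge_mon w (a, b)"
      using m(1) psubset_imp_subset[OF G'] by auto
    have "Poly_Mapping.keys m \<subseteq> Poly_Mapping.keys (edge_mon w (x, y))"
      unfolding m(2) by (auto simp: in_keys_iff lookup_add)
    then have "{a, b} \<subseteq> {x, y}" using ab e by (simp add: keys_edge_mon)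
    then have "(a, b) = (x, y)"
      using ab(1) no_loops[OF ab(1)] no_multi_edges[OF e(1)] by auto
    with ab m e show False by simp
  qed
qed

lemma min_gens_edge_ideal: "min_gens V (edge_ideal V E w) = edge_mon w ` E"
  by (rule min_gens_eq[OF is_min_gens_edge_ideal])

end

lemma bm_step_diamond:
  assumes "bm_step r S T" "bm_step r S U" "T \<noteq> U" "\<And>\<sigma>. \<sigma> \<in> fst S \<Longrightarrow> finite \<sigma>"
  shows "\<exists>W. bm_step r T W \<and> bm_step r U W"
proof -
  obtain \<sigma> \<Omega> A where S: "S = (\<Omega>, A)"
    and T: "T = (\<Omega> - {\<sigma>, \<sigma> - sb r \<sigma>}, if sb r \<sigma> = {} then A else insert (\<sigma>, \<sigma> - sb r \<sigma>) A)"
    and s: "\<sigma> \<in> \<Omega>" "\<And>\<rho>. \<rho> \<in> \<Omega> \<Longrightarrow> card \<rho> \<le> card \<sigma>"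
    by (rule bm_step.cases[OF assms(1)]) (rule that)
  obtain \<tau> \<Omega>' A' where S': "S = (\<Omega>', A')"
    and U': "U = (\<Omega>' - {\<tau>, \<tau> - sb r \<tau>}, if sb r \<tau> = {} then A' else insert (\<tau>, \<tau> - sb r \<tau>) A')"
    and t': "\<tau> \<in> \<Omega>'" "\<And>\<rho>. \<rho> \<in> \<Omega>' \<Longrightarrow> card \<rho> \<le> card \<tau>"
    by (rule bm_step.cases[OF assms(2)]) (rule that)
  have t: "\<tau> \<in> \<Omega>" "\<And>\<rho>. \<rho> \<in> \<Omega> \<Longrightarrow> card \<rho> \<le> card \<tau>"
    and U: "U = (\<Omega> - {\<tau>, \<tau> - sb r \<tau>}, if sb r \<tau> = {} then A else insert (\<tau>, \<tau> - sb r \<tau>) A)"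
    using S S' t' U' by simp_all
  have card_eq: "card \<sigma> = card \<tau>" using s t by (simp add: le_antisym)
  have neq: "\<sigma> \<noteq> \<tau>" using assms(3) T U by auto
  have fin: "finite \<sigma>" "finite \<tau>" using assms(4) s t S by auto
  have ne: "\<tau> \<noteq> \<sigma> - sb r \<sigma>" "\<sigma> \<noteq> \<tau> - sb r \<tau>"
    using card_eq neq fin card_subset_eq[of \<sigma> \<tau>] card_subset_eq[of \<tau> \<sigma>] by auto
  let ?B = "\<lambda>\<rho> A. if sb r \<rho> = {} then A else insert (\<rho>, \<rho> - sb r \<rho>) A"
  have 1: "bm_step r T (fst T - {\<tau>, \<tau> - sb r \<tau>}, ?B \<tau> (snd T))"
    using bm_step.intros[of \<tau> "fst T" r "snd T"] t neq ne T by auto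
  have 2: "bm_step r U (fst U - {\<sigma>, \<sigma> - sb r \<sigma>}, ?B \<sigma> (snd U))"
    using bm_step.intros[of \<sigma> "fst U" r "snd U"] s neq ne U by auto
  have "fst T - {\<tau>, \<tau> - sb r \<tau>} = fst U - {\<sigma>, \<sigma> - sb r \<sigma>}" using T U by auto
  moreover have "?B \<tau> (snd T) = ?B \<sigma> (snd U)" using T U by (auto simp: insert_commute)
  ultimately have eq: "(fst T - {\<tau>, \<tau> - sb r \<tau>}, ?B \<tau> (snd T)) =
      (fst U - {\<sigma>, \<sigma> - sb r \<sigma>}, ?B \<sigma> (snd U))"
    by (rule arg_cong2[where f = Pair])
  show ?thesis by (rule exI, rule conjI, rule 1, subst eq, rule 2)
qed

lemma bm_terminates:
  assumes "finite \<Omega>"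
  shows "\<exists>B. (bm_step r)\<^sup>*\<^sup>* (\<Omega>, A) ({}, B)"
  using assms
proof (induction "card \<Omega>" arbitrary: \<Omega> A rule: less_induct)
  case less
  show ?case
  proof (cases "\<Omega> = {}")
    case False
    let ?n = "Max (card ` \<Omega>)"
    have "?n \<in> card ` \<Omega>" using False less.prems by (intro Max_in) auto
    then obtain \<sigma> where s: "\<sigma> \<in> \<Omega>" "card \<sigma> = ?n" by auto
    have "card \<tau> \<le> card \<sigma>" if "\<tau> \<in> \<Omega>" for \<tau>
      using that less.prems by (simp add: s(2))
    then obtain A' where step: "bm_step r (\<Omega>, A) (\<Omega> - {\<sigma>, \<sigma> - sb r \<sigma>}, A')"
      using bm_step.intros[of \<sigma> \<Omega> r A] s(1) by blast
    have "card (\<Omega> - {\<sigma>, \<sigma> - sb r \<sigma>}) < card \<Omega>"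
      using s(1) less.prems by (intro psubset_card_mono) auto
    then obtain B where "(bm_step r)\<^sup>*\<^sup>* (\<Omega> - {\<sigma>, \<sigma> - sb r \<sigma>}, A') ({}, B)"
      using less.hyps less.prems by blast
    with step show ?thesis by (meson converse_rtranclp_into_rtranclp)
  qed auto
qed

lemma bm_matched_ex1:
  assumes "finite G"
  shows "\<exists>!A. bm_matched G r A"
proof -
  let ?step = "\<lambda>S T. bm_step r S T \<and> (\<forall>\<sigma>\<in>fst S. finite \<sigma>)"
  let ?S = "({\<sigma>. \<sigma> \<subseteq> G \<and> card \<sigma> \<ge> 3}, {})"
  have fin: "finite {\<sigma>. \<sigma> \<subseteq> G \<and> card \<sigma> \<ge> 3}" using assms by simp
  have keep: "fst T \<subseteq> fst S" if "bm_step r S T" for S T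
    using that by (auto elim!: bm_step.cases)
  have conf: "confluentp ?step"
  proof (intro strong_confluentp_imp_confluentp strong_confluentpI)
    fix S T U assume ST: "?step S T" and SU: "?step S U"
    show "\<exists>W. ?step\<^sup>*\<^sup>* T W \<and> ?step\<^sup>=\<^sup>= U W"
    proof (cases "T = U")
      case False
      then obtain W where "bm_step r T W" "bm_step r U W"
        using ST SU bm_step_diamond[of r S T U] by blast
      moreover have "\<forall>\<sigma>\<in>fst T. finite \<sigma>" "\<forall>\<sigma>\<in>fst U. finite \<sigma>"
        using ST SU keep[of S T] keep[of S U] by blast+
      ultimately show ?thesis by blast
    qed blast
  qed
  have lift: "?step\<^sup>*\<^sup>* S T" if "(bm_step r)\<^sup>*\<^sup>* S T" "\<forall>\<sigma>\<in>fst S. finite \<sigma>" for S T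
  proof -
    from that(1) have "?step\<^sup>*\<^sup>* S T \<and> fst T \<subseteq> fst S"
    proof (induction rule: rtranclp_induct)
      case (step T U)
      then have IH: "?step\<^sup>*\<^sup>* S T" "fst T \<subseteq> fst S" by auto
      then have "?step T U" using step(2) that(2) by blast
      with IH(1) have "?step\<^sup>*\<^sup>* S U" by (rule rtranclp.rtrancl_into_rtrancl)
      moreover have "fst U \<subseteq> fst S" using keep[OF step(2)] IH(2) by simp
      ultimately show ?case ..
    qed auto
    then show ?thesis ..
  qed
  have stop: "T = ({}, A)" if "?step\<^sup>*\<^sup>* ({}, A) T" for A T
    using that by (induction rule: rtranclp_induct) (auto elim!: bm_step.cases)
  have "\<exists>A. bm_matched G r A" unfolding bm_matched_def by (rule bm_terminates[OF fin])
  moreover have "A = B" if "bm_matched G r A" "bm_matched G r B" for A B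
  proof -
    have f: "\<forall>\<sigma>\<in>fst ?S. finite \<sigma>" using assms by (auto intro: finite_subset)
    have "?step\<^sup>*\<^sup>* ?S ({}, A)" "?step\<^sup>*\<^sup>* ?S ({}, B)"
      using lift[OF that(1)[unfolded bm_matched_def] f] lift[OF that(2)[unfolded bm_matched_def] f]
      by simp_all
    from confluentpD[OF conf this] obtain W
      where W: "?step\<^sup>*\<^sup>* ({}, A) W" "?step\<^sup>*\<^sup>* ({}, B) W" by (elim exE conjE)
    show ?thesis using stop[OF W(1)] stop[OF W(2)] by simp
  qed
  ultimately show ?thesis by blast
qed

end

theory Submission
  imports Defs
begin

text \<open>
  Fix an ordering of the generators and call \<open>n \<notin> \<sigma>\<close> a leading gap of \<open>\<sigma>\<close> if \<open>n\<close> is the smallest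
  bridge of \<open>\<sigma> \<union> {n}\<close>.  A leading gap of \<open>\<sigma> \<union> {n}\<close> is a leading gap of \<open>\<sigma>\<close> smaller than \<open>n\<close>
  (\<open>leading_gaps_insert\<close>).  Adding the smallest leading gap therefore leaves no leading gap, and
  this decides without recursion what the Barile-Macchia algorithm does: a set with a leading gap is
  removed as a target before its turn comes, so every edge starts at a set with a bridge and without
  leading gaps (\<open>bm_matched_subset\<close>).

  The forest enters through the ordering of its edges, obtained by deleting leaf edges one after the
  other: an edge deleted earlier is smaller.  When an edge is deleted, one of its endpoints lies on
  no remaining edge, so every edge meets larger edges in at most one of its two vertices.  This
  single property has two consequences.

  If \<open>m < m'\<close> are leading gaps of \<open>\<sigma>\<close>, then \<open>m\<close> is still a leading gap of \<open>\<sigma> \<union> {m'}\<close>.  A smaller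
  bridge \<open>k\<close> of \<open>\<sigma> \<union> {m, m'}\<close> would need \<open>m\<close> in one of its variables and \<open>m'\<close> in another, and would
  thus meet larger generators in two variables.  So only the smallest leading gap of \<open>\<sigma>\<close> can lead to
  a matched source, targets are hit once, and nothing is pruned
  (\<open>bm_matching_target_unique\<close>): the ideal is bridge-friendly.

  A critical set has neither bridges nor leading gaps.  Let \<open>\<sigma>\<close> and \<open>\<tau>\<close> be distinct critical sets with
  the same lcm, and let \<open>n \<in> \<tau> - \<sigma>\<close> be the smallest element of their symmetric difference.  Then \<open>n\<close>
  is a bridge of \<open>\<sigma> \<union> {n}\<close>, but not the smallest, which is some \<open>k < n\<close> in \<open>\<sigma> \<inter> \<tau>\<close>.  In one variable
  \<open>k\<close> is dominated in \<open>\<sigma> \<union> {n}\<close> by \<open>n\<close> alone.  In the variable where \<open>k\<close> is undominated in \<open>\<tau>\<close> it is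
  dominated by some \<open>f \<in> \<sigma> - \<tau>\<close>, which is larger than \<open>n\<close>.  Again \<open>k\<close> meets larger generators in two
  variables, a contradiction (\<open>critical_mon_lcm_inj\<close>).  As removing smallest bridges never creates
  directed cycles (\<open>acyclic_reverse_edges\<close>), the matching is a Batzies-Welker matching.
\<close>


section \<open>Bridges and least common multiples\<close>

lemma le_lookup_mon_lcm_iff:
  assumes "finite \<sigma>"
  shows "a \<le> Poly_Mapping.lookup (mon_lcm \<sigma>) x \<longleftrightarrow>
    a = 0 \<or> (\<exists>f\<in>\<sigma>. a \<le> Poly_Mapping.lookup f x)"
  using assms by (auto simp: lookup_mon_lcm Max_ge_iff)

lemma lookup_mon_lcm_mono:
  assumes "finite \<tau>" "\<sigma> \<subseteq> \<tau>"
  shows "Poly_Mapping.lookup (mon_lcm \<sigma>) x \<le> Poly_Mapping.lookup (mon_lcm \<tau>) x"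
proof -
  have "finite \<sigma>" using assms finite_subset by blast
  then have "Poly_Mapping.lookup (mon_lcm \<sigma>) x = 0 \<or>
      (\<exists>f\<in>\<sigma>. Poly_Mapping.lookup (mon_lcm \<sigma>) x \<le> Poly_Mapping.lookup f x)"
    by (simp flip: le_lookup_mon_lcm_iff)
  then show ?thesis using assms by (auto simp: le_lookup_mon_lcm_iff)
qed

lemma mon_lcm_remove_eq_iff:
  assumes "finite \<sigma>" "m \<in> \<sigma>"
  shows "mon_lcm (\<sigma> - {m}) = mon_lcm \<sigma> \<longleftrightarrow>
    (\<forall>x. Poly_Mapping.lookup m x \<le> Poly_Mapping.lookup (mon_lcm (\<sigma> - {m})) x)"
proof
  assume "mon_lcm (\<sigma> - {m}) = mon_lcm \<sigma>"
  then show "\<forall>x. Poly_Mapping.lookup m x \<le> Poly_Mapping.lookup (mon_lcm (\<sigma> - {m})) x"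
    using assms by (auto simp: le_lookup_mon_lcm_iff)
next
  assume m: "\<forall>x. Poly_Mapping.lookup m x \<le> Poly_Mapping.lookup (mon_lcm (\<sigma> - {m})) x"
  show "mon_lcm (\<sigma> - {m}) = mon_lcm \<sigma>"
  proof (rule poly_mapping_eqI, rule antisym)
    fix x
    show "Poly_Mapping.lookup (mon_lcm (\<sigma> - {m})) x \<le> Poly_Mapping.lookup (mon_lcm \<sigma>) x"
      using assms by (intro lookup_mon_lcm_mono) auto
    have "Poly_Mapping.lookup (mon_lcm \<sigma>) x = 0 \<or>
        (\<exists>f\<in>\<sigma>. Poly_Mapping.lookup (mon_lcm \<sigma>) x \<le> Poly_Mapping.lookup f x)"
      using assms by (simp flip: le_lookup_mon_lcm_iff)
    then show "Poly_Mapping.lookup (mon_lcm \<sigma>) x \<le> Poly_Mapping.lookup (mon_lcm (\<sigma> - {m})) x"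
    proof
      assume "\<exists>f\<in>\<sigma>. Poly_Mapping.lookup (mon_lcm \<sigma>) x \<le> Poly_Mapping.lookup f x"
      then obtain f where f: "f \<in> \<sigma>" "Poly_Mapping.lookup (mon_lcm \<sigma>) x \<le> Poly_Mapping.lookup f x"
        by auto
      show ?thesis
      proof (cases "f = m")
        case True
        with f m show ?thesis using order_trans by blast
      next
        case False
        with f assms show ?thesis by (auto simp: le_lookup_mon_lcm_iff)
      qed
    qed simp
  qed
qed

text \<open>
  Comparing exponents one variable at a time makes it possible to name, for a member that is not a
  bridge, a variable in which it is strictly above all other members; all arguments about bridges
  below work with such variables.
\<close>

lemma bridge_iff:
  assumes "finite \<sigma>"
  shows "bridge \<sigma> m \<longleftrightarrow> m \<in> \<sigma> \<and> (\<forall>x\<in>Poly_Mapping.keys m.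
    \<exists>f\<in>\<sigma> - {m}. Poly_Mapping.lookup m x \<le> Poly_Mapping.lookup f x)"
proof (cases "m \<in> \<sigma>")
  case True
  have "bridge \<sigma> m \<longleftrightarrow>
      (\<forall>x. Poly_Mapping.lookup m x \<le> Poly_Mapping.lookup (mon_lcm (\<sigma> - {m})) x)"
    unfolding bridge_def mon_lcm_remove_eq_iff[OF assms True] using True by simp
  also have "\<dots> \<longleftrightarrow> (\<forall>x. Poly_Mapping.lookup m x = 0 \<or>
      (\<exists>f\<in>\<sigma> - {m}. Poly_Mapping.lookup m x \<le> Poly_Mapping.lookup f x))"
    using assms by (subst le_lookup_mon_lcm_iff) simp_all
  finally show ?thesis using True by (simp only: in_keys_iff Ball_def simp_thms imp_conv_disj not_not)
qed (simp add: bridge_def)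

lemma bridge_mono:
  assumes "bridge \<sigma> m" "\<sigma> \<subseteq> \<tau>" "finite \<tau>"
  shows "bridge \<tau> m"
proof -
  have "finite \<sigma>" using assms finite_subset by blast
  then show ?thesis using assms by (simp add: bridge_iff) blast
qed

lemma bridge_insert_of_mon_lcm_eq:
  assumes "finite \<sigma>" "finite \<tau>" "mon_lcm \<sigma> = mon_lcm \<tau>" "n \<in> \<tau>" "n \<notin> \<sigma>"
  shows "bridge (insert n \<sigma>) n"
proof -
  have "Poly_Mapping.lookup n x \<le> Poly_Mapping.lookup (mon_lcm \<sigma>) x" for x
    using assms(2,4) unfolding assms(3) by (auto simp: le_lookup_mon_lcm_iff)
  moreover have "insert n \<sigma> - {n} = \<sigma>" using assms(5) by simp
  ultimately have "mon_lcm (insert n \<sigma> - {n}) = mon_lcm (insert n \<sigma>)"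
    using assms(1) by (subst mon_lcm_remove_eq_iff) simp_all
  then show ?thesis by (simp add: bridge_def)
qed


section \<open>Gaps that become the smallest bridge\<close>

definition leading_gaps ::
    "'v monomial set \<Rightarrow> 'v monomial rel \<Rightarrow> 'v monomial set \<Rightarrow> 'v monomial set" where
  "leading_gaps G r \<sigma> = {n \<in> G - \<sigma>. n \<in> sb r (insert n \<sigma>)}"

text \<open>
  For minimal generators, where sets with fewer than three elements have no bridges, this is the edge
  set found by the Barile-Macchia algorithm before pruning, described without reference to a run: the
  absence of leading gaps says that the source has not been removed as the target of an earlier edge.
\<close>

definition bm_matching ::
    "'v monomial set \<Rightarrow> 'v monomial rel \<Rightarrow> ('v monomial set \<times> 'v monomial set) set" where
  "bm_matching G r = {(\<sigma>, \<sigma> - {n}) | \<sigma> n. \<sigma> \<subseteq> G \<and> leading_gaps G r \<sigma> = {} \<and> n \<in> sb r \<sigma>}"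

locale ordered_generators =
  fixes G :: "'v monomial set" and r :: "'v monomial rel"
  assumes finite_gens: "finite G"
    and linear: "linear_order_on G r"
begin

lemma finite_subset_gens: "\<sigma> \<subseteq> G \<Longrightarrow> finite \<sigma>"
  using finite_gens finite_subset by blast

lemma order_antisym: "(a, b) \<in> r \<Longrightarrow> (b, a) \<in> r \<Longrightarrow> a = b"
  using linear by (auto simp: order_on_defs antisym_def)

lemma order_trans: "(a, b) \<in> r \<Longrightarrow> (b, c) \<in> r \<Longrightarrow> (a, c) \<in> r"
  using linear by (auto simp: order_on_defs elim: transE)

lemma order_total: "a \<in> G \<Longrightarrow> b \<in> G \<Longrightarrow> (a, b) \<in> r \<or> (b, a) \<in> r"
  using linear by (cases "a = b") (auto simp: order_on_defs total_on_def refl_on_def)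

lemma least_exists:
  assumes "S \<subseteq> G" "S \<noteq> {}"
  shows "\<exists>n\<in>S. \<forall>m\<in>S. (n, m) \<in> r"
  using finite_subset_gens[OF assms(1)] assms(2,1)
proof (induction rule: finite_ne_induct)
  case (singleton a)
  then show ?case using order_total[of a a] by auto
next
  case (insert a F)
  then obtain n where n: "n \<in> F" "\<forall>m\<in>F. (n, m) \<in> r" by auto
  then consider "(n, a) \<in> r" | "(a, n) \<in> r" "(a, a) \<in> r"
    using order_total[of n a] order_total[of a a] insert.prems by auto
  then show ?case using n by cases (use order_trans in blast)+
qed

lemma sb_eq: "n \<in> sb r \<sigma> \<Longrightarrow> sb r \<sigma> = {n}"
  by (auto simp: sb_def intro: order_antisym)

lemma sb_nonempty:
  assumes "bridge \<sigma> m" "\<sigma> \<subseteq> G"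
  obtains n where "n \<in> sb r \<sigma>"
proof -
  have "{m. bridge \<sigma> m} \<subseteq> G" "{m. bridge \<sigma> m} \<noteq> {}" using assms by (auto simp: bridge_def)
  from least_exists[OF this] obtain n where "bridge \<sigma> n" "\<And>k. bridge \<sigma> k \<Longrightarrow> (n, k) \<in> r" by blast
  then have "n \<in> sb r \<sigma>" by (simp add: sb_def)
  then show ?thesis by (rule that)
qed

lemma mem_bm_matchingD:
  assumes "(\<sigma>, \<tau>) \<in> bm_matching G r"
  obtains n where "\<sigma> \<subseteq> G" "leading_gaps G r \<sigma> = {}" "n \<in> sb r \<sigma>" "n \<in> \<sigma>" "\<tau> = \<sigma> - {n}"
    "n \<in> leading_gaps G r \<tau>"
proof -
  from assms obtain n where n: "\<sigma> \<subseteq> G" "leading_gaps G r \<sigma> = {}" "n \<in> sb r \<sigma>" "\<tau> = \<sigma> - {n}"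
    by (auto simp: bm_matching_def)
  moreover have "n \<in> \<sigma>" using n by (auto simp: sb_def bridge_def)
  moreover from this n have "n \<in> leading_gaps G r \<tau>"
    by (auto simp: leading_gaps_def insert_absorb)
  ultimately show ?thesis using that by blast
qed

text \<open>
  Where \<open>n\<close> is needed to dominate \<open>l\<close>, a member of \<open>\<sigma>\<close> dominates \<open>n\<close> and hence \<open>l\<close>, as \<open>n\<close> is a bridge
  of \<open>\<sigma> \<union> {n}\<close>; so \<open>l\<close> is already a bridge of \<open>\<sigma> \<union> {l}\<close>.  It remains the smallest one because passing
  to a subset creates no bridges.
\<close>

lemma leading_gaps_insert:
  assumes "\<sigma> \<subseteq> G" "n \<in> leading_gaps G r \<sigma>" "l \<in> leading_gaps G r (insert n \<sigma>)"
  shows "l \<in> leading_gaps G r \<sigma>" "(l, n) \<in> r" "l \<noteq> n"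
proof -
  note fin = finite_subset_gens[OF assms(1)]
  have n: "n \<in> G" "n \<notin> \<sigma>" "bridge (insert n \<sigma>) n"
    and l: "l \<in> G" "l \<notin> \<sigma>" "l \<noteq> n" "bridge (insert l (insert n \<sigma>)) l"
    and least: "\<And>k. bridge (insert l (insert n \<sigma>)) k \<Longrightarrow> (l, k) \<in> r"
    using assms by (auto simp: leading_gaps_def sb_def)
  show "l \<noteq> n" by fact
  show "(l, n) \<in> r"
    using least bridge_mono[OF n(3), of "insert l (insert n \<sigma>)"] fin by auto
  have "\<exists>f\<in>insert l \<sigma> - {l}. Poly_Mapping.lookup l x \<le> Poly_Mapping.lookup f x"
    if x: "x \<in> Poly_Mapping.keys l" for x
  proof -
    have pos: "Poly_Mapping.lookup l x > 0" using x by (simp add: in_keys_iff)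
    obtain f where f: "f \<in> insert n \<sigma>" "Poly_Mapping.lookup l x \<le> Poly_Mapping.lookup f x"
      using l x fin by (auto simp: bridge_iff)
    show ?thesis
    proof (cases "f = n")
      case True
      then have "x \<in> Poly_Mapping.keys n" using f pos by (simp add: in_keys_iff)
      then obtain g where "g \<in> \<sigma>" "Poly_Mapping.lookup n x \<le> Poly_Mapping.lookup g x"
        using n fin by (auto simp: bridge_iff)
      then show ?thesis using True f l by (intro bexI[of _ g]) auto
    qed (use f l in auto)
  qed
  then have "bridge (insert l \<sigma>) l" using fin by (simp add: bridge_iff)
  moreover have "(l, k) \<in> r" if "bridge (insert l \<sigma>) k" for k
    using least bridge_mono[OF that, of "insert l (insert n \<sigma>)"] fin by auto
  ultimately show "l \<in> leading_gaps G r \<sigma>" using l by (auto simp: leading_gaps_def sb_def)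
qed

text \<open>
  Adding the smallest leading gap \<open>n\<close> works: any leading gap of \<open>\<sigma> \<union> {n}\<close> would be a smaller leading
  gap of \<open>\<sigma>\<close>.
\<close>

lemma leading_gap_imp_matched:
  assumes "\<sigma> \<subseteq> G" "leading_gaps G r \<sigma> \<noteq> {}"
  obtains n where "n \<in> G - \<sigma>" "(insert n \<sigma>, \<sigma>) \<in> bm_matching G r"
proof -
  have "leading_gaps G r \<sigma> \<subseteq> G" by (auto simp: leading_gaps_def)
  from least_exists[OF this assms(2)] obtain n
    where n: "n \<in> leading_gaps G r \<sigma>" and least: "\<forall>m\<in>leading_gaps G r \<sigma>. (n, m) \<in> r" ..
  have "l \<notin> leading_gaps G r (insert n \<sigma>)" for l
  proof
    assume "l \<in> leading_gaps G r (insert n \<sigma>)"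
    note l = leading_gaps_insert[OF assms(1) n this]
    have "(n, l) \<in> r" using least l(1) by blast
    from order_antisym[OF this l(2)] l(3) show False by simp
  qed
  then have "leading_gaps G r (insert n \<sigma>) = {}" by blast
  moreover have "n \<in> G - \<sigma>" "n \<in> sb r (insert n \<sigma>)" using n by (auto simp: leading_gaps_def)
  ultimately have "(insert n \<sigma>, insert n \<sigma> - {n}) \<in> bm_matching G r"
    using assms(1) unfolding bm_matching_def mem_Collect_eq
    by (intro exI[of _ "insert n \<sigma>"] exI[of _ n]) auto
  then have "(insert n \<sigma>, \<sigma>) \<in> bm_matching G r"
    using \<open>n \<in> G - \<sigma>\<close> by simp
  with \<open>n \<in> G - \<sigma>\<close> show ?thesis by (rule that)
qed


section \<open>The Barile-Macchia algorithm computes this matching\<close>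

text \<open>
  The last clause makes the algorithm agree with the matching: a set still waiting has all its
  matched sources waiting too, so a set picked for its maximal cardinality has none.
\<close>

definition follows_matching :: "'v bm_state \<Rightarrow> bool" where
  "follows_matching S \<longleftrightarrow> fst S \<subseteq> Pow G \<and> snd S \<subseteq> bm_matching G r \<and>
     (\<forall>\<rho> \<sigma>. (\<rho>, \<sigma>) \<in> bm_matching G r \<longrightarrow> \<sigma> \<in> fst S \<longrightarrow> \<rho> \<in> fst S)"

lemma follows_matching_bm_step:
  assumes step: "bm_step r S T" and inv: "follows_matching S"
  shows "follows_matching T"
proof -
  have sub: "fst S \<subseteq> Pow G" and A: "snd S \<subseteq> bm_matching G r"
    and open_source: "\<And>\<sigma> \<rho>. \<sigma> \<in> fst S \<Longrightarrow> (\<rho>, \<sigma>) \<in> bm_matching G r \<Longrightarrow> \<rho> \<in> fst S"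
    using inv by (auto simp: follows_matching_def)
  obtain \<sigma> \<Omega> B where S: "S = (\<Omega>, B)"
    and T: "T = (\<Omega> - {\<sigma>, \<sigma> - sb r \<sigma>}, if sb r \<sigma> = {} then B else insert (\<sigma>, \<sigma> - sb r \<sigma>) B)"
    and s: "\<sigma> \<in> \<Omega>" "\<And>\<rho>. \<rho> \<in> \<Omega> \<Longrightarrow> card \<rho> \<le> card \<sigma>"
    by (rule bm_step.cases[OF step]) (rule that)
  have sG: "\<sigma> \<subseteq> G" using s sub S by auto
  have no_gap: "leading_gaps G r \<sigma> = {}"
  proof (rule ccontr)
    assume "leading_gaps G r \<sigma> \<noteq> {}"
    then obtain n where n: "n \<in> G - \<sigma>" "(insert n \<sigma>, \<sigma>) \<in> bm_matching G r"
      using leading_gap_imp_matched[OF sG] by blast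
    then have "card (insert n \<sigma>) \<le> card \<sigma>" using open_source s S by auto
    then show False using n finite_subset_gens[OF sG] by auto
  qed
  have matched: "(\<sigma>, \<sigma> - sb r \<sigma>) \<in> bm_matching G r" if "sb r \<sigma> \<noteq> {}"
  proof -
    from that obtain n where n: "n \<in> sb r \<sigma>" by blast
    then have "sb r \<sigma> = {n}" by (rule sb_eq)
    with n sG no_gap show ?thesis by (auto simp: bm_matching_def)
  qed
  have "\<rho> \<in> fst T" if \<sigma>': "\<sigma>' \<in> fst T" and \<rho>: "(\<rho>, \<sigma>') \<in> bm_matching G r" for \<sigma>' \<rho>
  proof -
    have "\<rho> \<in> \<Omega>" using open_source \<sigma>' \<rho> S T by auto
    moreover have "\<rho> \<noteq> \<sigma>"
    proof
      assume "\<rho> = \<sigma>"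
      with \<rho> obtain n where "n \<in> sb r \<sigma>" "\<sigma>' = \<sigma> - {n}" by (auto elim: mem_bm_matchingD)
      then have "\<sigma>' = \<sigma> - sb r \<sigma>" using sb_eq by simp
      with \<sigma>' T show False by simp
    qed
    moreover have "\<rho> \<noteq> \<sigma> - sb r \<sigma>"
    proof
      assume eq: "\<rho> = \<sigma> - sb r \<sigma>"
      show False
      proof (cases "sb r \<sigma> = {}")
        case True
        with eq \<open>\<rho> \<noteq> \<sigma>\<close> show False by simp
      next
        case False
        \<comment> \<open>A matched target has a leading gap, and so is not the source of a pair.\<close>
        from matched[OF this] have "leading_gaps G r \<rho> \<noteq> {}"
          unfolding eq by (auto elim: mem_bm_matchingD)
        moreover have "leading_gaps G r \<rho> = {}" using \<rho> by (rule mem_bm_matchingD)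
        ultimately show False by simp
      qed
    qed
    ultimately show ?thesis using T by simp
  qed
  moreover have "fst T \<subseteq> Pow G" using sub S T by auto
  moreover have "snd T \<subseteq> bm_matching G r" using A S T matched by auto
  ultimately show ?thesis by (simp add: follows_matching_def)
qed

lemma bm_matched_subset:
  assumes "bm_matched G r A"
  shows "A \<subseteq> bm_matching G r"
proof -
  let ?S = "({\<sigma>. \<sigma> \<subseteq> G \<and> card \<sigma> \<ge> 3}, {}) :: 'v bm_state"
  have "\<rho> \<subseteq> G \<and> card \<rho> \<ge> 3" if "card \<sigma> \<ge> 3" "(\<rho>, \<sigma>) \<in> bm_matching G r" for \<sigma> \<rho>
  proof -
    from that(2) have "\<rho> \<subseteq> G" "\<sigma> \<subseteq> \<rho>" by (auto elim: mem_bm_matchingD)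
    then show ?thesis using that(1) card_mono[of \<rho> \<sigma>] finite_subset_gens by fastforce
  qed
  then have init: "follows_matching ?S" by (auto simp: follows_matching_def)
  have "(bm_step r)\<^sup>*\<^sup>* ?S ({}, A)" using assms by (simp add: bm_matched_def)
  then have "follows_matching ({}, A)"
    by (induction rule: rtranclp_induct) (use init follows_matching_bm_step in blast)+
  then show ?thesis by (simp add: follows_matching_def)
qed


section \<open>Acyclicity\<close>

text \<open>
  Consider the strongly connected component \<open>C\<close> of a vertex on a directed cycle.  The lcm never
  increases along an edge and is constant on \<open>C\<close>.  The same holds for the cardinality \<open>p\<close>, raised by
  one on targets of \<open>A\<close>; hence inside \<open>C\<close> a step removing an element starts at a set that has just
  been entered by a reversed edge, that is, by adding its smallest bridge.  Take the smallest element
  \<open>n\<close> added inside \<open>C\<close>.  On the way back it is removed again, from a set \<open>\<rho>\<close> of which it is a bridge,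
  since the lcm does not change, but not the smallest one, since that step is not an edge of \<open>A\<close>.
  The smallest bridge of \<open>\<rho>\<close> was added inside \<open>C\<close> and is smaller than \<open>n\<close>, a contradiction.
\<close>

lemma acyclic_reverse_edges:
  assumes sub: "A \<subseteq> {(\<sigma>, \<sigma> - {n}) | \<sigma> n. \<sigma> \<subseteq> G \<and> n \<in> sb r \<sigma>}"
    and disjoint: "\<And>\<sigma> \<tau> \<rho>. (\<sigma>, \<tau>) \<in> A \<Longrightarrow> (\<tau>, \<rho>) \<notin> A"
  shows "acyclic (reverse_edges (subset_graph G) A)"
proof (rule ccontr)
  let ?R = "reverse_edges (subset_graph G) A"
  assume "\<not> acyclic ?R"
  then obtain x where x: "(x, x) \<in> ?R\<^sup>+" by (auto simp: acyclic_def)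
  define C where "C = {y. (x, y) \<in> ?R\<^sup>* \<and> (y, x) \<in> ?R\<^sup>*}"
  have pred: "\<exists>z\<in>C. (z, y) \<in> ?R" if "y \<in> C" for y
  proof -
    have "(x, y) \<in> ?R\<^sup>+" using that x by (auto simp: C_def dest: rtranclD)
    then obtain z where "(x, z) \<in> ?R\<^sup>*" "(z, y) \<in> ?R" by (meson tranclD2)
    then show ?thesis using that by (auto simp: C_def intro: converse_rtrancl_into_rtrancl)
  qed
  have const: "f y = f z"
    if mono: "\<And>a b. (a, b) \<in> ?R \<Longrightarrow> f b \<le> f a" and yz: "y \<in> C" "z \<in> C" for f :: "'v monomial set \<Rightarrow> 'b::order" and y z
  proof -
    have "f b \<le> f a" if "(a, b) \<in> ?R\<^sup>*" for a b
      using that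
    proof induction
      case (step b c)
      show ?case using mono[OF step(2)] step(3) by (rule order.trans)
    qed simp
    moreover have "(y, z) \<in> ?R\<^sup>*" "(z, y) \<in> ?R\<^sup>*" using yz by (auto simp: C_def intro: rtrancl_trans)
    ultimately show ?thesis by (simp add: order.antisym)
  qed
  have A: "\<sigma> \<subseteq> G \<and> \<tau> = \<sigma> - sb r \<sigma> \<and> (\<exists>n\<in>\<sigma>. sb r \<sigma> = {n})" if "(\<sigma>, \<tau>) \<in> A" for \<sigma> \<tau>
  proof -
    from that sub obtain n where n: "\<sigma> \<subseteq> G" "\<tau> = \<sigma> - {n}" "n \<in> sb r \<sigma>" by blast
    then have "n \<in> \<sigma>" by (simp add: sb_def bridge_def)
    with n sb_eq[OF n(3)] show ?thesis by blast
  qed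
  have A_lcm: "mon_lcm \<sigma> = mon_lcm \<tau>" if "(\<sigma>, \<tau>) \<in> A" for \<sigma> \<tau>
    using that sub by (auto simp: sb_def bridge_def)
  have A_card: "card \<sigma> = card \<tau> + 1" if "(\<sigma>, \<tau>) \<in> A" for \<sigma> \<tau>
  proof -
    from A[OF that] obtain n where "\<sigma> \<subseteq> G" "n \<in> \<sigma>" "\<tau> = \<sigma> - {n}" by auto
    then show ?thesis using finite_subset_gens[of \<sigma>] card_Suc_Diff1[of \<sigma> n] by simp
  qed
  have R: "(b, a) \<in> A \<or> (b \<subseteq> a \<and> a \<subseteq> G \<and> card a = card b + 1 \<and> (a, b) \<notin> A)" if "(a, b) \<in> ?R" for a b
    using that by (auto simp: reverse_edges_def subset_graph_def)
  have lcm_const: "mon_lcm y = mon_lcm z" if "y \<in> C" "z \<in> C" for y z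
  proof -
    have "Poly_Mapping.lookup (mon_lcm y) = Poly_Mapping.lookup (mon_lcm z)"
    proof (rule const[OF _ that])
      fix a b assume "(a, b) \<in> ?R"
      from R[OF this] show "Poly_Mapping.lookup (mon_lcm b) \<le> Poly_Mapping.lookup (mon_lcm a)"
        using lookup_mon_lcm_mono[of a b] finite_subset_gens[of a] A_lcm by (auto simp: le_fun_def)
    qed
    then show ?thesis by (simp add: lookup_inject)
  qed
  define p where "p \<sigma> = (if \<sigma> \<in> snd ` A then card \<sigma> + 1 else card \<sigma>)" for \<sigma>
  have p_const: "p y = p z" if "y \<in> C" "z \<in> C" for y z
  proof (rule const[OF _ that])
    fix a b assume "(a, b) \<in> ?R"
    from R[OF this] show "p b \<le> p a"
    proof
      assume "(b, a) \<in> A"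
      moreover from this disjoint have "b \<notin> snd ` A" by auto
      ultimately show ?thesis using A_card by (force simp: p_def)
    qed (auto simp: p_def)
  qed
  have down: "a \<notin> snd ` A \<and> b \<in> snd ` A" if "(a, b) \<in> ?R" "(b, a) \<notin> A" "a \<in> C" "b \<in> C" for a b
    using p_const[OF that(3,4)] R[OF that(1)] that(2) by (auto simp: p_def split: if_splits)
  have entered: "\<exists>c\<in>C. (a, c) \<in> A" if "(a, b) \<in> ?R" "(b, a) \<notin> A" "a \<in> C" "b \<in> C" for a b
  proof -
    from pred[OF that(3)] obtain c where c: "c \<in> C" "(c, a) \<in> ?R" by auto
    then have "(a, c) \<in> A" using down[OF c(2) _ c(1) that(3)] down[OF that] by blast
    with c show ?thesis by blast
  qed
  let ?N = "{n. \<exists>\<sigma>\<in>C. \<exists>\<tau>\<in>C. (\<sigma>, \<tau>) \<in> A \<and> n \<in> sb r \<sigma>}"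
  have NG: "?N \<subseteq> G"
  proof
    fix n assume "n \<in> ?N"
    then obtain \<sigma> \<tau> where "(\<sigma>, \<tau>) \<in> A" "n \<in> sb r \<sigma>" by blast
    with A[of \<sigma> \<tau>] show "n \<in> G" by auto
  qed
  have "x \<in> C" by (simp add: C_def)
  then obtain z where z: "z \<in> C" "(z, x) \<in> ?R" using pred by auto
  obtain \<sigma>0 \<tau>0 where "\<sigma>0 \<in> C" "\<tau>0 \<in> C" "(\<sigma>0, \<tau>0) \<in> A"
  proof (cases "(x, z) \<in> A")
    case True
    with z \<open>x \<in> C\<close> show ?thesis by (intro that)
  next
    case False
    from entered[OF z(2) this z(1) \<open>x \<in> C\<close>] z show ?thesis by (elim bexE) (rule that)
  qed
  moreover from A[OF this(3)] obtain n0 where "n0 \<in> sb r \<sigma>0" by auto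
  ultimately have "n0 \<in> ?N" by blast
  then have "?N \<noteq> {}" by (metis empty_iff)
  from least_exists[OF NG this] obtain n where n: "n \<in> ?N" and least: "\<forall>m\<in>?N. (n, m) \<in> r" ..
  from n obtain \<sigma> \<tau> where st: "\<sigma> \<in> C" "\<tau> \<in> C" "(\<sigma>, \<tau>) \<in> A" "n \<in> sb r \<sigma>" by blast
  have "n \<in> \<sigma>" "n \<notin> \<tau>" using A[OF st(3)] st(4) by auto
  have "(\<sigma>, \<tau>) \<in> ?R\<^sup>*" using st by (auto simp: C_def)
  then have "\<exists>\<rho> \<rho>'. (\<sigma>, \<rho>) \<in> ?R\<^sup>* \<and> (\<rho>, \<rho>') \<in> ?R \<and> (\<rho>', \<tau>) \<in> ?R\<^sup>* \<and> n \<in> \<rho> \<and> n \<notin> \<rho>'"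
    using \<open>n \<in> \<sigma>\<close>
  proof (induction rule: converse_rtrancl_induct)
    case base
    with \<open>n \<notin> \<tau>\<close> show ?case by simp
  next
    case (step y z)
    show ?case
    proof (cases "n \<in> z")
      case True
      with step show ?thesis by (meson converse_rtrancl_into_rtrancl)
    next
      case False
      with step show ?thesis by blast
    qed
  qed
  then obtain \<rho> \<rho>' where \<rho>: "(\<sigma>, \<rho>) \<in> ?R\<^sup>*" "(\<rho>, \<rho>') \<in> ?R" "(\<rho>', \<tau>) \<in> ?R\<^sup>*" "n \<in> \<rho>" "n \<notin> \<rho>'"
    by blast
  have C: "\<rho> \<in> C" "\<rho>' \<in> C"
  proof -
    have "(x, \<sigma>) \<in> ?R\<^sup>*" "(\<tau>, x) \<in> ?R\<^sup>*" using st by (auto simp: C_def)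
    then have "(x, \<rho>) \<in> ?R\<^sup>*" "(\<rho>', x) \<in> ?R\<^sup>*"
      using \<rho>(1,3) by (meson rtrancl_trans)+
    moreover from this have "(\<rho>, x) \<in> ?R\<^sup>*" "(x, \<rho>') \<in> ?R\<^sup>*"
      using \<rho>(2) by (metis converse_rtrancl_into_rtrancl, metis rtrancl.rtrancl_into_rtrancl)
    ultimately show "\<rho> \<in> C" "\<rho>' \<in> C" unfolding C_def by simp_all
  qed
  have up: "(\<rho>', \<rho>) \<notin> A" using A[of \<rho>' \<rho>] \<rho>(4,5) by auto
  with R[OF \<rho>(2)] have d: "\<rho>' \<subseteq> \<rho>" "\<rho> \<subseteq> G" "card \<rho> = card \<rho>' + 1" "(\<rho>, \<rho>') \<notin> A" by auto
  have "\<rho>' = \<rho> - {n}"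
    using d \<rho>(4,5) finite_subset_gens[OF d(2)] by (intro card_subset_eq) auto
  then have "bridge \<rho> n" using lcm_const[OF C] \<rho>(4) by (simp add: bridge_def)
  from entered[OF \<rho>(2) up C] obtain \<rho>'' where e: "\<rho>'' \<in> C" "(\<rho>, \<rho>'') \<in> A" ..
  from A[OF e(2)] obtain m where m: "sb r \<rho> = {m}" "\<rho>'' = \<rho> - {m}" by auto
  then have "(m, n) \<in> r" using \<open>bridge \<rho> n\<close> by (auto simp: sb_def)
  moreover have "(n, m) \<in> r" using m(1) e C(1) by (intro bspec[OF least]) blast
  ultimately have "m = n" by (rule order_antisym)
  with m e(2) d(4) \<open>\<rho>' = \<rho> - {n}\<close> show False by simp
qed

end


section \<open>Orderings with at most one upward variable\<close>

text \<open>
  In the language of elimination orderings: when \<open>k\<close> is removed before all larger generators, it is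
  attached to the remaining ones through at most one variable.
\<close>

locale sparsely_ordered_generators = ordered_generators +
  assumes at_most_one_upward_variable:
    "\<lbrakk>k \<in> G; m \<in> G; m' \<in> G; (k, m) \<in> r; k \<noteq> m; (k, m') \<in> r; k \<noteq> m';
      x \<in> Poly_Mapping.keys k \<inter> Poly_Mapping.keys m;
      y \<in> Poly_Mapping.keys k \<inter> Poly_Mapping.keys m'\<rbrakk> \<Longrightarrow> x = y"
begin

text \<open>
  A bridge \<open>k < m\<close> of \<open>\<sigma> \<union> {m, m'}\<close> is a bridge of neither \<open>\<sigma> \<union> {m}\<close> nor \<open>\<sigma> \<union> {m'}\<close>.  So in some
  variable \<open>x\<close> only \<open>m\<close> dominates \<open>k\<close>, and in some variable \<open>y\<close> only \<open>m'\<close> does, which forces \<open>x \<noteq> y\<close>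
  against the sparseness of the ordering.
\<close>

lemma leading_gap_remains:
  assumes "\<sigma> \<subseteq> G" "m \<in> leading_gaps G r \<sigma>" "m' \<in> leading_gaps G r \<sigma>" "(m, m') \<in> r" "m \<noteq> m'"
  shows "m \<in> leading_gaps G r (insert m' \<sigma>)"
proof -
  let ?\<tau> = "insert m (insert m' \<sigma>)"
  note fin = finite_subset_gens[OF assms(1)]
  have m: "m \<in> G" "m \<notin> \<sigma>" "bridge (insert m \<sigma>) m" "\<And>k. bridge (insert m \<sigma>) k \<Longrightarrow> (m, k) \<in> r"
    and m': "m' \<in> G" "m' \<notin> \<sigma>" "\<And>k. bridge (insert m' \<sigma>) k \<Longrightarrow> (m', k) \<in> r"
    using assms by (auto simp: leading_gaps_def sb_def)
  have b: "bridge ?\<tau> m" using bridge_mono[OF m(3), of ?\<tau>] fin by auto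
  have "?\<tau> \<subseteq> G" using assms(1) m m' by auto
  with b obtain k where k: "k \<in> sb r ?\<tau>" by (rule sb_nonempty)
  have "k = m"
  proof (rule ccontr)
    assume "k \<noteq> m"
    have kb: "bridge ?\<tau> k" and km: "(k, m) \<in> r" using k b by (auto simp: sb_def)
    have km': "(k, m') \<in> r" using km assms(4) by (rule order_trans)
    have "k \<noteq> m'" using km assms(4,5) order_antisym by blast
    have ks: "k \<in> \<sigma>" using kb \<open>k \<noteq> m\<close> \<open>k \<noteq> m'\<close> by (auto simp: bridge_def)
    have "\<not> bridge (insert m' \<sigma>) k" "\<not> bridge (insert m \<sigma>) k"
      using m(4) m'(3) km km' \<open>k \<noteq> m\<close> \<open>k \<noteq> m'\<close> order_antisym by blast+
    then obtain x y where x: "x \<in> Poly_Mapping.keys k"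
        "\<And>f. f \<in> insert m' \<sigma> - {k} \<Longrightarrow> \<not> Poly_Mapping.lookup k x \<le> Poly_Mapping.lookup f x"
      and y: "y \<in> Poly_Mapping.keys k"
        "\<And>f. f \<in> insert m \<sigma> - {k} \<Longrightarrow> \<not> Poly_Mapping.lookup k y \<le> Poly_Mapping.lookup f y"
      using fin ks by (simp add: bridge_iff) blast
    have dom: "\<exists>f\<in>?\<tau> - {k}. Poly_Mapping.lookup k z \<le> Poly_Mapping.lookup f z"
      if "z \<in> Poly_Mapping.keys k" for z
      using kb that fin by (simp add: bridge_iff)
    have mx: "Poly_Mapping.lookup k x \<le> Poly_Mapping.lookup m x" using dom[OF x(1)] x(2) by blast
    have my: "Poly_Mapping.lookup k y \<le> Poly_Mapping.lookup m' y" using dom[OF y(1)] y(2) by blast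
    have "x = y"
    proof (rule at_most_one_upward_variable[of k m m'])
      show "k \<in> G" using ks assms(1) by auto
      show "x \<in> Poly_Mapping.keys k \<inter> Poly_Mapping.keys m"
        "y \<in> Poly_Mapping.keys k \<inter> Poly_Mapping.keys m'"
        using x(1) y(1) mx my by (auto simp: in_keys_iff)
    qed fact+
    then show False using mx y(2)[of m] \<open>k \<noteq> m\<close> by auto
  qed
  with k m assms(5) show ?thesis by (simp add: leading_gaps_def)
qed

lemma bm_matching_target_unique:
  assumes "(\<sigma>, \<tau>) \<in> bm_matching G r" "(\<sigma>', \<tau>) \<in> bm_matching G r"
  shows "\<sigma> = \<sigma>'"
proof -
  have *: "(n, n') \<notin> r \<or> n = n'"
    if "insert n' \<tau> \<subseteq> G" "leading_gaps G r (insert n' \<tau>) = {}" "n \<in> leading_gaps G r \<tau>"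
      "n' \<in> leading_gaps G r \<tau>" for n n'
    using leading_gap_remains[of \<tau> n n'] that by auto
  from assms(1) obtain n where "n \<in> \<sigma>" "\<tau> = \<sigma> - {n}" and n: "\<sigma> \<subseteq> G"
    "leading_gaps G r \<sigma> = {}" "n \<in> leading_gaps G r \<tau>"
    by (rule mem_bm_matchingD)
  then have \<sigma>: "\<sigma> = insert n \<tau>" by blast
  from assms(2) obtain n' where "n' \<in> \<sigma>'" "\<tau> = \<sigma>' - {n'}" and n': "\<sigma>' \<subseteq> G"
    "leading_gaps G r \<sigma>' = {}" "n' \<in> leading_gaps G r \<tau>"
    by (rule mem_bm_matchingD)
  then have \<sigma>': "\<sigma>' = insert n' \<tau>" by blast
  have "(n, n') \<in> r \<or> (n', n) \<in> r" using n(3) n'(3) by (intro order_total) (auto simp: leading_gaps_def)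
  then have "n = n'" using *[of n' n] *[of n n'] n n' \<sigma> \<sigma>' by blast
  then show ?thesis using \<sigma> \<sigma>' by simp
qed

lemma critical_bm_matchingD:
  assumes "critical G (bm_matching G r) \<sigma>"
  shows "leading_gaps G r \<sigma> = {}" "\<not> bridge \<sigma> m"
proof -
  have sG: "\<sigma> \<subseteq> G" and un: "\<And>\<tau>. (\<sigma>, \<tau>) \<notin> bm_matching G r" "\<And>\<tau>. (\<tau>, \<sigma>) \<notin> bm_matching G r"
    using assms by (auto simp: critical_def)
  show gaps: "leading_gaps G r \<sigma> = {}" using leading_gap_imp_matched[OF sG] un by blast
  show "\<not> bridge \<sigma> m"
  proof
    assume "bridge \<sigma> m"
    then obtain n where "n \<in> sb r \<sigma>" using sG by (rule sb_nonempty)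
    then have "(\<sigma>, \<sigma> - {n}) \<in> bm_matching G r" using sG gaps by (auto simp: bm_matching_def)
    with un show False by blast
  qed
qed

text \<open>
  The smallest element \<open>n\<close> of the symmetric difference produces a common member \<open>k < n\<close> that is a
  bridge of neither set, and two distinct variables in which \<open>k\<close> meets larger generators.
\<close>

lemma critical_mon_lcm_inj:
  assumes "critical G (bm_matching G r) \<sigma>" "critical G (bm_matching G r) \<tau>"
    and lcm: "mon_lcm \<sigma> = mon_lcm \<tau>"
  shows "\<sigma> = \<tau>"
proof (rule ccontr)
  assume "\<sigma> \<noteq> \<tau>"
  \<comment> \<open>The roles of the two sets depend on which of them contains the smallest difference.\<close>
  have *: False
    if c: "critical G (bm_matching G r) \<sigma>" "critical G (bm_matching G r) \<tau>"
      and lcm: "mon_lcm \<sigma> = mon_lcm \<tau>" and n: "n \<in> \<tau> - \<sigma>"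
      and least: "\<And>f. f \<in> (\<sigma> - \<tau>) \<union> (\<tau> - \<sigma>) \<Longrightarrow> (n, f) \<in> r" for \<sigma> \<tau> n
  proof -
    have sub: "\<sigma> \<subseteq> G" "\<tau> \<subseteq> G" using c by (auto simp: critical_def)
    note fin = sub[THEN finite_subset_gens]
    have nG: "n \<in> G" using n sub by auto
    have b: "bridge (insert n \<sigma>) n"
      using n fin lcm by (intro bridge_insert_of_mon_lcm_eq[of \<sigma> \<tau>]) auto
    have "insert n \<sigma> \<subseteq> G" using sub nG by auto
    with b obtain k where k: "k \<in> sb r (insert n \<sigma>)" by (rule sb_nonempty)
    then have kb: "bridge (insert n \<sigma>) k" and kn: "(k, n) \<in> r" using b by (auto simp: sb_def)
    have "k \<noteq> n" using k n nG critical_bm_matchingD(1)[OF c(1)] by (auto simp: leading_gaps_def)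
    then have ks: "k \<in> \<sigma>" using kb by (auto simp: bridge_def)
    have kt: "k \<in> \<tau>" using least[of k] kn \<open>k \<noteq> n\<close> ks order_antisym by blast
    obtain x where x: "x \<in> Poly_Mapping.keys k"
      "\<And>f. f \<in> \<sigma> - {k} \<Longrightarrow> \<not> Poly_Mapping.lookup k x \<le> Poly_Mapping.lookup f x"
      using critical_bm_matchingD(2)[OF c(1), of k] fin ks by (auto simp: bridge_iff)
    obtain y where y: "y \<in> Poly_Mapping.keys k"
      "\<And>f. f \<in> \<tau> - {k} \<Longrightarrow> \<not> Poly_Mapping.lookup k y \<le> Poly_Mapping.lookup f y"
      using critical_bm_matchingD(2)[OF c(2), of k] fin kt by (auto simp: bridge_iff)
    have dom: "\<exists>f\<in>insert n \<sigma> - {k}. Poly_Mapping.lookup k z \<le> Poly_Mapping.lookup f z"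
      if "z \<in> Poly_Mapping.keys k" for z
      using kb that fin by (simp add: bridge_iff)
    have nx: "Poly_Mapping.lookup k x \<le> Poly_Mapping.lookup n x" using dom[OF x(1)] x(2) by blast
    obtain f where f: "f \<in> insert n \<sigma> - {k}" "Poly_Mapping.lookup k y \<le> Poly_Mapping.lookup f y"
      using dom[OF y(1)] by blast
    have "f \<noteq> n" using y(2)[of n] f n \<open>k \<noteq> n\<close> by auto
    then have fs: "f \<in> \<sigma>" "f \<notin> \<tau>" using f y(2) by auto
    have nf: "(n, f) \<in> r" using least fs by blast
    have "x = y"
    proof (rule at_most_one_upward_variable[of k n f])
      show "k \<in> G" "f \<in> G" using ks fs sub by auto
      show "(k, f) \<in> r" using kn nf by (rule order_trans)
      show "k \<noteq> f" using f by auto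
      show "x \<in> Poly_Mapping.keys k \<inter> Poly_Mapping.keys n"
        "y \<in> Poly_Mapping.keys k \<inter> Poly_Mapping.keys f"
        using x(1) y(1) nx f(2) by (auto simp: in_keys_iff)
    qed fact+
    then show False using nx y(2)[of n] n \<open>k \<noteq> n\<close> by auto
  qed
  have "(\<sigma> - \<tau>) \<union> (\<tau> - \<sigma>) \<subseteq> G" "(\<sigma> - \<tau>) \<union> (\<tau> - \<sigma>) \<noteq> {}"
    using assms \<open>\<sigma> \<noteq> \<tau>\<close> by (auto simp: critical_def)
  from least_exists[OF this] obtain n where n: "n \<in> (\<sigma> - \<tau>) \<union> (\<tau> - \<sigma>)"
    and least: "\<forall>m\<in>(\<sigma> - \<tau>) \<union> (\<tau> - \<sigma>). (n, m) \<in> r" ..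
  from n show False
  proof
    assume "n \<in> \<sigma> - \<tau>"
    then show False using *[OF assms(2,1) lcm[symmetric], of n] least by blast
  next
    assume "n \<in> \<tau> - \<sigma>"
    then show False using *[OF assms, of n] least by blast
  qed
qed

theorem batzies_welker_bm_matching: "batzies_welker_matching G (bm_matching G r)"
proof -
  let ?M = "bm_matching G r"
  have source_not_target: "(\<tau>, \<rho>) \<notin> ?M" if "(\<sigma>, \<tau>) \<in> ?M" for \<sigma> \<tau> \<rho>
    using that by (auto elim!: mem_bm_matchingD)
  have source_unique: "\<tau> = \<tau>'" if "(\<sigma>, \<tau>) \<in> ?M" "(\<sigma>, \<tau>') \<in> ?M" for \<sigma> \<tau> \<tau>'
    using that sb_eq by (fastforce elim!: mem_bm_matchingD)
  have "?M \<subseteq> subset_graph G"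
  proof clarify
    fix \<sigma> \<tau> assume "(\<sigma>, \<tau>) \<in> ?M"
    then obtain n where "\<sigma> \<subseteq> G" "n \<in> \<sigma>" "\<tau> = \<sigma> - {n}" by (rule mem_bm_matchingD)
    then show "(\<sigma>, \<tau>) \<in> subset_graph G"
      using finite_subset_gens[of \<sigma>] card_Suc_Diff1[of \<sigma> n] by (auto simp: subset_graph_def)
  qed
  moreover have "e = e'"
    if "e \<in> ?M" "e' \<in> ?M" "\<sigma> \<in> {fst e, snd e}" "\<sigma> \<in> {fst e', snd e'}" for e e' \<sigma>
    using that source_unique source_not_target bm_matching_target_unique
    by (cases e; cases e') (auto; metis)
  moreover have "acyclic (reverse_edges (subset_graph G) ?M)"
    using source_not_target by (intro acyclic_reverse_edges) (auto simp: bm_matching_def)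
  moreover have "mon_lcm \<sigma> = mon_lcm \<tau>" if "(\<sigma>, \<tau>) \<in> ?M" for \<sigma> \<tau>
    using that by (auto simp: bm_matching_def sb_def bridge_def)
  ultimately have "lcm_homogeneous_acyclic_matching G ?M"
    unfolding lcm_homogeneous_acyclic_matching_def by blast
  then show ?thesis
    using critical_mon_lcm_inj by (auto simp: batzies_welker_matching_def)
qed

text \<open>Pruning removes an edge only if another edge has the same target.\<close>

theorem potentially_type2_imp_type2:
  assumes "potentially_type2 G r \<sigma>"
  shows "type2 G r \<sigma>"
proof -
  from assms obtain A where A: "bm_matched G r A" "(\<sigma>, \<sigma> - sb r \<sigma>) \<in> A"
    by (auto simp: potentially_type2_def)
  have "\<sigma>' = \<sigma>" if "(\<sigma>', \<sigma> - sb r \<sigma>) \<in> A" for \<sigma>'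
    using that A bm_matched_subset[OF A(1)] bm_matching_target_unique by blast
  then have "(\<sigma>, \<sigma> - sb r \<sigma>) \<in> bm_prune r A" using A(2) by (auto simp: bm_prune_def)
  with A(1) show ?thesis by (auto simp: type2_def)
qed

end


section \<open>Eliminating leaves\<close>

text \<open>
  A leaf of the whole set becomes the smallest generator.  This cannot spoil the condition for the
  others, which only looks upwards.
\<close>

lemma elimination_ordering_exists:
  fixes G :: "'v monomial set"
  assumes "finite G"
    and leaf: "\<And>S. S \<subseteq> G \<Longrightarrow> S \<noteq> {} \<Longrightarrow> \<exists>k\<in>S. \<forall>m\<in>S - {k}. \<forall>m'\<in>S - {k}.
      \<forall>x\<in>Poly_Mapping.keys k \<inter> Poly_Mapping.keys m.
      \<forall>y\<in>Poly_Mapping.keys k \<inter> Poly_Mapping.keys m'. x = y"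
  shows "\<exists>r. sparsely_ordered_generators G r"
  using assms
proof (induction "card G" arbitrary: G)
  case 0
  then have "sparsely_ordered_generators G {}"
    by unfold_locales (auto simp: order_on_defs)
  then show ?case ..
next
  case (Suc c)
  have "G \<noteq> {}" using Suc.hyps(2) by auto
  with Suc.prems(2)[of G] obtain k where k: "k \<in> G"
    and one: "\<And>m m' x y. m \<in> G - {k} \<Longrightarrow> m' \<in> G - {k} \<Longrightarrow>
      x \<in> Poly_Mapping.keys k \<inter> Poly_Mapping.keys m \<Longrightarrow>
      y \<in> Poly_Mapping.keys k \<inter> Poly_Mapping.keys m' \<Longrightarrow> x = y"
    by blast
  have "\<exists>r. sparsely_ordered_generators (G - {k}) r"
  proof (rule Suc.hyps(1))
    show "c = card (G - {k})" using Suc.hyps(2) Suc.prems(1) k by simp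
    show "finite (G - {k})" using Suc.prems(1) by simp
  qed (rule Suc.prems(2), auto)
  then obtain r where "sparsely_ordered_generators (G - {k}) r" ..
  then interpret sparsely_ordered_generators "G - {k}" r .
  let ?r = "{k} \<times> G \<union> r"
  have r: "r \<subseteq> (G - {k}) \<times> (G - {k})" "refl_on (G - {k}) r" "total_on (G - {k}) r"
    using linear by (auto simp: order_on_defs)
  have "linear_order_on G ?r"
    unfolding order_on_defs
  proof (intro conjI)
    show "?r \<subseteq> G \<times> G" using r(1) k by auto
    show "refl_on G ?r" using r(2) k by (auto simp: refl_on_def)
    show "trans ?r" using r(1) by (auto intro!: transI intro: order_trans)
    show "antisym ?r" using r(1) by (auto intro!: antisymI intro: order_antisym)
    show "total_on G ?r" using r(3) by (auto simp: total_on_def)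
  qed
  then have "sparsely_ordered_generators G ?r"
  proof (unfold_locales, goal_cases)
    case 1
    show ?case by (rule Suc.prems(1))
  next
    case (3 k' m m' x y)
    show ?case
    proof (cases "k' = k")
      case True
      with 3 one show ?thesis by (metis Diff_iff singletonD)
    next
      case False
      then have "(k', m) \<in> r" "(k', m') \<in> r" using 3 by auto
      with r(1) 3 show ?thesis using at_most_one_upward_variable[of k' m m' x y] by blast
    qed
  qed
  then show ?case ..
qed

text \<open>
  The end \<open>v\<close> of a longest path lies on no edge but the last edge of the path: another edge at \<open>v\<close>
  would either prolong the path or lead back to it and close a cycle.
\<close>

lemma (in weighted_oriented_forest) leaf_edge_exists:
  assumes F: "F \<subseteq> E" "F \<noteq> {}"
  shows "\<exists>a b v. (a, b) \<in> F \<and> v \<in> {a, b} \<and>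
    (\<forall>c d. (c, d) \<in> F \<longrightarrow> v \<in> {c, d} \<longrightarrow> (c, d) = (a, b))"
proof -
  let ?adj = "\<lambda>x y. (x, y) \<in> F \<union> F\<inverse>"
  let ?P = "\<lambda>c. length c \<ge> 2 \<and> distinct c \<and> set c \<subseteq> V \<and> successively ?adj c"
  have adj_V: "x \<in> V" "y \<in> V" "x \<noteq> y" if "?adj x y" for x y
    using that F(1) edges_in_verts no_loops by auto
  obtain a0 b0 where ab0: "(a0, b0) \<in> F" using F(2) by auto
  then have "?P [a0, b0]" using adj_V[of a0 b0] by auto
  moreover have "\<forall>c. ?P c \<longrightarrow> length c < card V + 1"
    using finite_verts by (metis card_mono distinct_card less_add_one order_le_less_trans)
  ultimately obtain c where c: "?P c" and longest: "\<And>c'. ?P c' \<Longrightarrow> length c' \<le> length c"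
    using ex_has_greatest_nat[of ?P "[a0, b0]" length "card V + 1"] by blast
  then obtain v u ps where c_eq: "c = v # u # ps"
    by (cases c; cases "tl c") auto
  have vu: "?adj v u" using c c_eq by auto
  have only_u: "z = u" if z: "?adj v z" for z
  proof (rule ccontr)
    assume "z \<noteq> u"
    show False
    proof (cases "z \<in> set c")
      case False
      then have "?P (z # c)" using c c_eq z adj_V[OF z] by auto
      then show False using longest[of "z # c"] by simp
    next
      case True
      then obtain i where i: "i < length c" "c ! i = z" by (auto simp: in_set_conv_nth)
      have "c ! 0 \<noteq> z" "c ! 1 \<noteq> z" using c_eq \<open>z \<noteq> u\<close> adj_V(3)[OF z] by auto
      then have "i \<noteq> 0" "i \<noteq> 1" using i(2) by metis+
      then have i2: "i \<ge> 2" by simp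
      let ?c = "take (Suc i) c"
      have "successively ?adj ?c"
        using c successively_append_iff[of ?adj ?c "drop (Suc i) c"] by simp
      then have "successively (\<lambda>x y. (x, y) \<in> E \<union> E\<inverse>) ?c"
        by (rule successively_mono) (use F(1) in auto)
      moreover have "last ?c = z" using i by (simp add: take_Suc_conv_app_nth)
      moreover have "hd ?c = v" using c_eq by simp
      moreover have "length ?c \<ge> 3" "distinct ?c" using i i2 c by auto
      ultimately have "undirected_cycle E ?c" using z F(1) by (auto simp: undirected_cycle_def)
      then show False using no_cycles by blast
    qed
  qed
  obtain a b where ab: "(a, b) \<in> F" "{a, b} = {v, u}" using vu by auto
  have "(p, q) = (a, b)" if pq: "(p, q) \<in> F" "v \<in> {p, q}" for p q
  proof -
    from pq have "{p, q} = {v, u}" using only_u by auto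
    then have "(p, q) = (a, b) \<or> (p, q) = (b, a)" using ab(2) by (auto simp: doubleton_eq_iff)
    then show ?thesis using pq(1) ab(1) F(1) no_multi_edges by blast
  qed
  moreover have "v \<in> {a, b}" using ab(2) by auto
  ultimately show ?thesis
    using ab(1) by (intro exI[of _ a] exI[of _ b] exI[of _ v] conjI allI impI)
qed

lemma (in weighted_oriented_forest) edge_ordering_exists:
  "\<exists>r. sparsely_ordered_generators (edge_mon w ` E) r"
proof (rule elimination_ordering_exists)
  show "finite (edge_mon w ` E)"
    using finite_verts edges_in_verts by (meson finite_SigmaI finite_imageI finite_subset)
  fix S assume S: "S \<subseteq> edge_mon w ` E" "S \<noteq> {}"
  let ?F = "{e \<in> E. edge_mon w e \<in> S}"
  have "?F \<subseteq> E" "?F \<noteq> {}" using S by auto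
  from leaf_edge_exists[OF this] obtain a b v where ab: "(a, b) \<in> ?F" "v \<in> {a, b}"
    and leaf: "\<forall>c d. (c, d) \<in> ?F \<longrightarrow> v \<in> {c, d} \<longrightarrow> (c, d) = (a, b)"
    by (elim exE conjE)
  have v: "v \<notin> Poly_Mapping.keys m" if "m \<in> S - {edge_mon w (a, b)}" for m
  proof -
    from that S(1) obtain c d where cd: "(c, d) \<in> E" "m = edge_mon w (c, d)" by auto
    then have "(c, d) \<in> ?F" "(c, d) \<noteq> (a, b)" using that by auto
    with leaf have "v \<notin> {c, d}" by blast
    then show ?thesis using cd by (simp add: keys_edge_mon)
  qed
  have "Poly_Mapping.keys (edge_mon w (a, b)) = {a, b}" using ab(1) by (intro keys_edge_mon) auto
  then have "x = y"
    if "m \<in> S - {edge_mon w (a, b)}" "m' \<in> S - {edge_mon w (a, b)}"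
      "x \<in> Poly_Mapping.keys (edge_mon w (a, b)) \<inter> Poly_Mapping.keys m"
      "y \<in> Poly_Mapping.keys (edge_mon w (a, b)) \<inter> Poly_Mapping.keys m'" for m m' x y
    using that v[of m] v[of m'] ab(2) by auto
  moreover have "edge_mon w (a, b) \<in> S" using ab(1) by simp
  ultimately show "\<exists>k\<in>S. \<forall>m\<in>S - {k}. \<forall>m'\<in>S - {k}.
      \<forall>x\<in>Poly_Mapping.keys k \<inter> Poly_Mapping.keys m.
      \<forall>y\<in>Poly_Mapping.keys k \<inter> Poly_Mapping.keys m'. x = y"
    by (intro bexI[of _ "edge_mon w (a, b)"] ballI)
qed

theorem corollary3p24:
  fixes V :: "'v set" and E :: "('v \<times> 'v) set" and w :: "'v \<Rightarrow> nat"
  assumes "weighted_oriented_forest V E w"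
  shows "bridge_friendly V (edge_ideal V E w :: ('v, 'k::field) mpoly set) \<and>
         has_batzies_welker_matching V (edge_ideal V E w :: ('v, 'k::field) mpoly set)"
proof -
  interpret weighted_oriented_forest V E w by (rule assms)
  obtain r where "sparsely_ordered_generators (edge_mon w ` E) r"
    using edge_ordering_exists ..
  then interpret sparsely_ordered_generators "edge_mon w ` E" r .
  show ?thesis
    unfolding bridge_friendly_def has_batzies_welker_matching_def min_gens_edge_ideal
    using linear potentially_type2_imp_type2 batzies_welker_bm_matching by blast
qed

end
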